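(* There is a universal constant $C$ such that for every Boolean function $f:\{0,1\}^n\to\{0,1\}$, $\deg(f)\le C\,\mathrm{Q}(f)^2$.
   Context: $\deg(f)$ is the degree of the unique multilinear real polynomial agreeing with $f$ on $\{0,1\}^n$. $\mathrm{Q}(f)$ is the bounded-error quantum query complexity of $f$: the minimum number of queries of a quantum query algorithm that outputs $f(x)$ with probability at least $2/3$ on every input $x$. *)

theory Defs
  imports "HOL-Analysis.Analysis" "Jordan_Normal_Form.Schur_Decomposition"
begin

(* Boolean functions f : {0,1}^n -> {0,1} are modelled as f :: bool list => bool,
   of which only the values on lists of length n matter. *)

definition bool_inputs :: "nat \<Rightarrow> bool list set" where
  "bool_inputs n = {x. length x = n}"

definition bit :: "bool \<Rightarrow> real" where
  "bit b = (if b then 1 else 0)"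

definition multilinear_rep :: "nat \<Rightarrow> (nat set \<Rightarrow> real) \<Rightarrow> (bool list \<Rightarrow> bool) \<Rightarrow> bool" where
  "multilinear_rep n c f \<longleftrightarrow>
     (\<forall>x \<in> bool_inputs n.
        bit (f x) = (\<Sum>S\<in>Pow {..<n}. c S * (\<Prod>i\<in>S. bit (x ! i))))"

definition multilinear_degree :: "nat \<Rightarrow> (nat set \<Rightarrow> real) \<Rightarrow> nat" where
  "multilinear_degree n c = Max ({0} \<union> {card S | S. S \<subseteq> {..<n} \<and> c S \<noteq> 0})"

definition bdeg :: "nat \<Rightarrow> (bool list \<Rightarrow> bool) \<Rightarrow> nat" where
  "bdeg n f = multilinear_degree n (THE c. multilinear_rep n c f \<and> (\<forall>S. \<not> S \<subseteq> {..<n} \<longrightarrow> c S = 0))"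

(* State space C^(m*(n+1)), m >= 1 workspace dimension.  Basis index k encodes the
   query register q = k mod (n+1): q = 0 means "no query", q = i+1 queries bit x_i. *)

definition unitary_mat :: "nat \<Rightarrow> complex mat \<Rightarrow> bool" where
  "unitary_mat N U \<longleftrightarrow> U \<in> carrier_mat N N \<and> mat_adjoint U * U = 1\<^sub>m N"

definition query_op :: "nat \<Rightarrow> nat \<Rightarrow> bool list \<Rightarrow> complex mat" where
  "query_op n N x = mat N N (\<lambda>(k, l).
      if k = l then (let q = k mod (n + 1) in if q \<noteq> 0 \<and> x ! (q - 1) then -1 else 1) else 0)"

definition final_state :: "nat \<Rightarrow> nat \<Rightarrow> complex mat list \<Rightarrow> bool list \<Rightarrow> complex vec" where
  "final_state n N Us x =
     foldl (\<lambda>v U. U *\<^sub>v (query_op n N x *\<^sub>v v)) (hd Us *\<^sub>v unit_vec N 0) (tl Us)"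

definition prob_one :: "nat \<Rightarrow> nat \<Rightarrow> complex mat list \<Rightarrow> nat set \<Rightarrow> bool list \<Rightarrow> real" where
  "prob_one n N Us Acc x = (\<Sum>k\<in>Acc. (cmod (final_state n N Us x $ k))\<^sup>2)"

definition prob_correct :: "nat \<Rightarrow> nat \<Rightarrow> complex mat list \<Rightarrow> nat set \<Rightarrow> (bool list \<Rightarrow> bool) \<Rightarrow> bool list \<Rightarrow> real" where
  "prob_correct n N Us Acc f x = (if f x then prob_one n N Us Acc x else 1 - prob_one n N Us Acc x)"

definition computes_bounded_error :: "nat \<Rightarrow> nat \<Rightarrow> (bool list \<Rightarrow> bool) \<Rightarrow> bool" where
  "computes_bounded_error n T f \<longleftrightarrow>
     (\<exists>m Us Acc. m \<ge> 1 \<and> length Us = T + 1 \<and>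
        (\<forall>U \<in> set Us. unitary_mat (m * (n + 1)) U) \<and> Acc \<subseteq> {..<m * (n + 1)} \<and>
        (\<forall>x \<in> bool_inputs n. prob_correct n (m * (n + 1)) Us Acc f x \<ge> 2 / 3))"

definition Qcomp :: "nat \<Rightarrow> (bool list \<Rightarrow> bool) \<Rightarrow> nat" where
  "Qcomp n f = (LEAST T. computes_bounded_error n T f)"

end

theory Submission
  imports Defs
begin

text \<open>
  Let \<open>d = deg f\<close> and let \<open>S\<close> be the support of a monomial of degree \<open>d\<close> of \<open>f\<close>.  On the subcube of
  inputs vanishing off \<open>S\<close>, \<open>f\<close> correlates with parity, so \<open>f\<close> or its negation agrees with
  parity on a strict majority \<open>H\<close> of the points.  Huang's signed adjacency matrix of the cube squares to
  \<open>d\<close> and has \<open>sqrt d\<close> as an eigenvalue on half of the space, hence has an eigenvector supported on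
  \<open>H\<close>; all cube edges inside \<open>H\<close> are sensitive for \<open>f\<close>.  The absolute values \<open>w\<close> of this
  eigenvector are the weights of a quantum adversary argument: the weighted sum of the inner
  products \<open>Re \<langle>\<psi>\<^sub>x, \<psi>\<^sub>y\<rangle>\<close> over sensitive edges starts at \<open>W \<ge> sqrt d * \<parallel>w\<parallel>\<^sup>2\<close>, decreases by at
  most \<open>2 * \<parallel>w\<parallel>\<^sup>2\<close> per query, and must end below \<open>17/18 * W\<close>.  Hence \<open>sqrt d \<le> 36 * T\<close>.

  As \<open>Qcomp\<close> is a \<open>LEAST\<close>, which is unspecified for an empty predicate, one also needs that some
  algorithm computes \<open>f\<close>; reading the input bit by bit does.
\<close>

unbundle no vec_syntax

section \<open>Homogeneous linear systems\<close>

text \<open>Gaussian elimination by induction on the equations \<open>J\<close>: a zero row is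
  dropped; otherwise a pivot \<open>p\<close> removes one equation and one unknown, so the unknowns
  still outnumber the equations.\<close>

lemma homogeneous_system_nontrivial_solution:
  fixes M :: "'b \<Rightarrow> 'a \<Rightarrow> 'c::field"
  assumes "finite J" "finite I" "card J < card I"
  shows "\<exists>u. (\<exists>i\<in>I. u i \<noteq> 0) \<and> (\<forall>j\<in>J. (\<Sum>i\<in>I. M j i * u i) = 0)"
  using assms
proof (induction J arbitrary: I M rule: finite_induct)
  case empty
  then obtain i where "i \<in> I" by fastforce
  then show ?case by (intro exI[of _ "\<lambda>_. 1"]) auto
next
  case (insert j J)
  show ?case
  proof (cases "\<forall>i\<in>I. M j i = 0")
    case True
    have "card J < card I" using insert by simp
    from insert.IH[OF insert.prems(1) this, of M] True show ?thesis by auto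
  next
    case False
    then obtain p where p: "p \<in> I" "M j p \<noteq> 0" by auto
    define M' where "M' k i = M k i - M k p * M j i / M j p" for k i
    have "card J < card (I - {p})" using insert p by (simp add: card_Diff_singleton)
    from insert.IH[OF _ this, of M'] insert.prems obtain u where
      u: "\<exists>i\<in>I - {p}. u i \<noteq> 0" "\<And>k. k \<in> J \<Longrightarrow> (\<Sum>i\<in>I - {p}. M' k i * u i) = 0" by auto
    \<comment> \<open>Back substitution: equation \<open>j\<close> dictates the value at the
      pivot.\<close>
    define u' where "u' = u(p := - (\<Sum>i\<in>I - {p}. M j i * u i) / M j p)"
    have split: "(\<Sum>i\<in>I. M k i * u' i) = M k p * u' p + (\<Sum>i\<in>I - {p}. M k i * u i)" for k
    proof -
      have "(\<Sum>i\<in>I. M k i * u' i) = M k p * u' p + (\<Sum>i\<in>I - {p}. M k i * u' i)"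
        using p insert.prems by (simp add: sum.remove)
      also have "(\<Sum>i\<in>I - {p}. M k i * u' i) = (\<Sum>i\<in>I - {p}. M k i * u i)"
        by (rule sum.cong) (auto simp: u'_def)
      finally show ?thesis .
    qed
    have "(\<Sum>i\<in>I. M j i * u' i) = 0" unfolding split using p(2) by (simp add: u'_def)
    moreover have "(\<Sum>i\<in>I. M k i * u' i) = 0" if "k \<in> J" for k
    proof -
      have "0 = (\<Sum>i\<in>I - {p}. M k i * u i - M k p / M j p * (M j i * u i))"
        using u(2)[OF that] by (simp add: M'_def algebra_simps)
      also have "\<dots> = (\<Sum>i\<in>I - {p}. M k i * u i) - M k p / M j p * (\<Sum>i\<in>I - {p}. M j i * u i)"
        by (simp add: sum_subtractf sum_distrib_left)
      finally show ?thesis unfolding split by (simp add: u'_def)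
    qed
    moreover have "\<exists>i\<in>I. u' i \<noteq> 0" using u(1) by (auto simp: u'_def)
    ultimately show ?thesis by (intro exI[of _ u']) auto
  qed
qed

section \<open>The signed hypercube\<close>

text \<open>Subsets of \<open>S\<close> serve as the vertices of the cube; \<open>toggle i\<close>
  crosses the edge in direction \<open>i\<close>.\<close>

definition toggle :: "'a \<Rightarrow> 'a set \<Rightarrow> 'a set" where
  "toggle i R = (if i \<in> R then R - {i} else insert i R)"

lemma toggle_toggle [simp]: "toggle i (toggle i R) = R"
  by (auto simp: toggle_def)

lemma toggle_commute: "toggle i (toggle j R) = toggle j (toggle i R)"
  by (auto simp: toggle_def)

lemma mem_toggle: "j \<in> toggle i R \<longleftrightarrow> (if j = i then i \<notin> R else j \<in> R)"
  by (auto simp: toggle_def)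

lemma finite_toggle [simp]: "finite (toggle i R) \<longleftrightarrow> finite R"
  by (auto simp: toggle_def)

lemma toggle_subset: "i \<in> S \<Longrightarrow> R \<subseteq> S \<Longrightarrow> toggle i R \<subseteq> S"
  by (auto simp: toggle_def)

lemma bij_betw_toggle_Pow: "i \<in> S \<Longrightarrow> bij_betw (toggle i) (Pow S) (Pow S)"
  by (rule bij_betwI[where g = "toggle i"]) (auto simp: toggle_subset[THEN subsetD])

lemma even_card_toggle: "finite R \<Longrightarrow> even (card (toggle i R)) \<longleftrightarrow> odd (card R)"
  by (auto simp: toggle_def card_Diff_singleton card_gt_0_iff)

text \<open>Huang's signing of the hypercube, in Jordan-Wigner form: the operators
  \<open>u \<mapsto> (\<lambda>R. edge_sign i R * u (toggle i R))\<close> are pairwise anticommuting involutions.\<close>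

definition edge_sign :: "nat \<Rightarrow> nat set \<Rightarrow> real" where
  "edge_sign i R = (-1) ^ card {j\<in>R. j < i}"

definition signed_adj :: "nat set \<Rightarrow> (nat set \<Rightarrow> real) \<Rightarrow> nat set \<Rightarrow> real" where
  "signed_adj S u R = (\<Sum>i\<in>S. edge_sign i R * u (toggle i R))"

text \<open>Only directions above \<open>i\<close> notice a change at \<open>i\<close>. So for two
  distinct directions exactly one of the two signs flips, which is the anticommutation.\<close>

lemma edge_sign_toggle:
  assumes "finite R"
  shows "edge_sign j (toggle i R) = (if i < j then - edge_sign j R else edge_sign j R)"
proof (cases "i < j")
  case True
  then have "{k \<in> toggle i R. k < j} = toggle i {k \<in> R. k < j}"
    by (auto simp: toggle_def)
  with True assms show ?thesis
    by (simp add: edge_sign_def minus_one_power_iff even_card_toggle)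
next
  case False
  then have "{k \<in> toggle i R. k < j} = {k \<in> R. k < j}"
    by (auto simp: toggle_def)
  with False show ?thesis by (simp add: edge_sign_def)
qed

lemma edge_sign_square [simp]: "edge_sign i R * edge_sign i R = 1"
  by (simp add: edge_sign_def flip: power_mult_distrib)

lemma abs_edge_sign [simp]: "\<bar>edge_sign i R\<bar> = 1"
  by (simp add: edge_sign_def power_abs)

text \<open>In the expanded square the terms for \<open>(i, j)\<close> and \<open>(j, i)\<close>
  cancel when \<open>i \<noteq> j\<close>, and each diagonal term returns
  \<open>u R\<close>.\<close>

lemma signed_adj_signed_adj:
  assumes "finite S" "finite R"
  shows "signed_adj S (signed_adj S u) R = real (card S) * u R"
proof -
  define g where "g i j = edge_sign i R * edge_sign j (toggle i R) * u (toggle j (toggle i R))" for i j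
  have "signed_adj S (signed_adj S u) R = (\<Sum>i\<in>S. \<Sum>j\<in>S. g i j)"
    by (simp add: signed_adj_def g_def sum_distrib_left mult.assoc)
  moreover have "g i j + g j i = (if i = j then 2 * u R else 0)" for i j
  proof (cases "i = j")
    case True
    have "edge_sign i R * (edge_sign i R * u R) = u R"
      by (simp flip: mult.assoc)
    then show ?thesis using True assms by (simp add: g_def edge_sign_toggle)
  next
    case False
    then show ?thesis using assms
      by (cases "i < j") (simp_all add: g_def edge_sign_toggle toggle_commute[of j i])
  qed
  then have "(\<Sum>i\<in>S. \<Sum>j\<in>S. g i j + g j i) = 2 * real (card S) * u R"
    using assms by simp
  moreover have "(\<Sum>i\<in>S. \<Sum>j\<in>S. g i j + g j i) = 2 * (\<Sum>i\<in>S. \<Sum>j\<in>S. g i j)"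
    by (simp add: sum.distrib sum.swap[of "\<lambda>i j. g j i"])
  ultimately show ?thesis by simp
qed

lemma signed_adj_linear:
  "signed_adj S (\<lambda>R. a * u R + b * v R) R = a * signed_adj S u R + b * signed_adj S v R"
  by (simp add: signed_adj_def sum.distrib sum_distrib_left algebra_simps)

lemma sum_Pow_supported:
  assumes "finite S" "R \<in> Pow S"
  shows "(\<Sum>Q\<in>Pow S. (if Q = R then (a::real) else 0) * u Q) = a * u R"
proof -
  have "(\<Sum>Q\<in>Pow S. (if Q = R then a else 0) * u Q) = (\<Sum>Q\<in>Pow S. if Q = R then a * u Q else 0)"
    by (rule sum.cong) auto
  then show ?thesis using assms by simp
qed

text \<open>For \<open>u\<close> supported on the sets avoiding \<open>p\<close>, the vector \<open>(A + sqrt d) u\<close> is an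
  eigenvector whose restriction to the sets containing \<open>p\<close> is \<open>u\<close> up to signs.  This
  parametrises the eigenspace by \<open>2 ^ (d - 1)\<close> free coordinates, more than the number
  of constraints imposed by vanishing off \<open>H\<close>.\<close>

lemma eigenvector_supported_on_majority:
  assumes S: "finite S" and H: "H \<subseteq> Pow S" "2 ^ card S < 2 * card H"
  obtains v where "\<And>R. R \<subseteq> S \<Longrightarrow> signed_adj S v R = sqrt (card S) * v R"
    "\<And>R. R \<in> Pow S - H \<Longrightarrow> v R = 0" "\<exists>R\<in>Pow S. v R \<noteq> 0"
proof (cases "S = {}")
  case True
  have "card H > 0" using H(2) by (cases "card H") auto
  then have "H \<noteq> {}" by auto
  with H(1) True have "H = {{}}" by auto
  \<comment> \<open>With \<open>S\<close> empty the operator and the eigenvalue are both 0, so a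
    constant works.\<close>
  with True show thesis by (intro that[of "\<lambda>_. 1"]) (auto simp: signed_adj_def)
next
  case False
  then obtain p where p: "p \<in> S" by auto
  define d where "d = card S"
  define I where "I = Pow (S - {p})"
  \<comment> \<open>One equation per vertex off \<open>H\<close>, one unknown per vertex avoiding
    \<open>p\<close>: less than half of the cube against exactly half.\<close>
  have "card (Pow S) = 2 * card I"
    by (simp only: I_def card_Pow finite_Diff S card.remove[OF S p] power_Suc)
  moreover have "card (Pow S - H) = card (Pow S) - card H"
    using S H(1) by (intro card_Diff_subset) (auto intro: finite_subset)
  moreover have "0 < card I" using S by (auto simp: I_def card_gt_0_iff)
  ultimately have card: "card (Pow S - H) < card I"
    using H(2) S by (simp add: card_Pow)
  define ext where "ext u R = (if p \<in> R then 0 else u R :: real)" for u R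
  \<comment> \<open>The matrix of \<open>A + sqrt d\<close>, with only the columns of vertices
    avoiding \<open>p\<close>.\<close>
  define M where "M R Q = (\<Sum>i\<in>S. if p \<notin> toggle i R \<and> Q = toggle i R then edge_sign i R else 0)
      + (if p \<notin> R \<and> Q = R then sqrt d else 0)" for R Q
  have M: "(\<Sum>Q\<in>I. M R Q * u Q) = signed_adj S (ext u) R + sqrt d * ext u R" if R: "R \<subseteq> S" for u R
  proof -
    have aux: "(\<Sum>Q\<in>I. (if p \<notin> R' \<and> Q = R' then a else 0) * u Q) = a * ext u R'"
      if "R' \<subseteq> S" for R' a
    proof (cases "p \<in> R'")
      case False
      then have "R' \<in> Pow (S - {p})" using that by auto
      then show ?thesis using False S sum_Pow_supported[of "S - {p}" R' a u]
        by (simp add: ext_def I_def)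
    qed (simp add: ext_def)
    have "(\<Sum>Q\<in>I. M R Q * u Q) =
        (\<Sum>i\<in>S. \<Sum>Q\<in>I. (if p \<notin> toggle i R \<and> Q = toggle i R then edge_sign i R else 0) * u Q)
        + (\<Sum>Q\<in>I. (if p \<notin> R \<and> Q = R then sqrt d else 0) * u Q)"
      unfolding M_def distrib_right sum.distrib sum_distrib_right
      by (subst sum.swap) simp
    also have "\<dots> = signed_adj S (ext u) R + sqrt d * ext u R"
      using R by (simp only: aux signed_adj_def toggle_subset cong: sum.cong)
    finally show ?thesis .
  qed
  obtain u where u: "\<exists>Q\<in>I. u Q \<noteq> 0" "\<And>R. R \<in> Pow S - H \<Longrightarrow> (\<Sum>Q\<in>I. M R Q * u Q) = 0"
    using homogeneous_system_nontrivial_solution[OF _ _ card, of M] S by (auto simp: I_def)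
  define v where "v R = signed_adj S (ext u) R + sqrt d * ext u R" for R
  show thesis
  proof (rule that[of v])
    show "v R = 0" if "R \<in> Pow S - H" for R
      using u(2)[OF that] M[of R] that by (simp add: v_def)
    show "signed_adj S v R = sqrt (card S) * v R" if "R \<subseteq> S" for R
    proof -
      have "finite R" using that S by (rule finite_subset)
      \<comment> \<open>Since \<open>A\<close> squares to \<open>d\<close>,
        \<open>A (A + sqrt d) = d + sqrt d A = sqrt d (A + sqrt d)\<close>.\<close>
      have "signed_adj S v R = signed_adj S (signed_adj S (ext u)) R + sqrt d * signed_adj S (ext u) R"
        using signed_adj_linear[of S 1 "signed_adj S (ext u)" "sqrt d" "ext u" R]
        by (simp add: v_def[abs_def])
      also have "\<dots> = d * ext u R + sqrt d * signed_adj S (ext u) R"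
        using S \<open>finite R\<close> by (simp add: signed_adj_signed_adj d_def)
      also have "\<dots> = sqrt (card S) * v R"
        by (simp add: v_def d_def distrib_left flip: mult.assoc)
      finally show ?thesis .
    qed
    from u(1) obtain Q where Q: "Q \<subseteq> S" "p \<notin> Q" "u Q \<noteq> 0" by (auto simp: I_def)
    \<comment> \<open>Among the neighbours of \<open>insert p Q\<close> only \<open>Q\<close> avoids
      \<open>p\<close>, so \<open>v\<close> equals \<open>u Q\<close> there up to sign and cannot
      vanish.\<close>
    have ext: "ext u (toggle i (insert p Q)) = (if i = p then u Q else 0)" for i
      using Q by (auto simp: ext_def toggle_def)
    have "signed_adj S (ext u) (insert p Q) =
        (\<Sum>i\<in>S. if i = p then edge_sign i (insert p Q) * u Q else 0)"
      unfolding signed_adj_def ext by (intro sum.cong) auto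
    then have "v (insert p Q) = edge_sign p (insert p Q) * u Q"
      using S p by (simp add: v_def) (simp add: ext_def)
    moreover have "edge_sign p (insert p Q) \<noteq> 0" by (simp add: edge_sign_def)
    ultimately show "\<exists>R\<in>Pow S. v R \<noteq> 0"
      using Q p by (intro bexI[of _ "insert p Q"]) auto
  qed
qed

section \<open>Correlation with parity and sensitive edges\<close>

lemma sum_minus_one_power_card_Pow:
  assumes "finite S" "S \<noteq> {}"
  shows "(\<Sum>R\<in>Pow S. (-1) ^ card R :: real) = 0"
proof -
  obtain p where p: "p \<in> S" using assms by auto
  \<comment> \<open>Toggling a fixed \<open>p\<close> permutes the cube and reverses every
    sign.\<close>
  have "(\<Sum>R\<in>Pow S. (-1) ^ card R :: real) = (\<Sum>R\<in>Pow S. (-1) ^ card (toggle p R))"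
    using sum.reindex_bij_betw[OF bij_betw_toggle_Pow[OF p], of "\<lambda>R. (-1) ^ card R :: real"] by simp
  also have "\<dots> = (\<Sum>R\<in>Pow S. - ((-1) ^ card R))"
  proof (intro sum.cong refl)
    fix R assume "R \<in> Pow S"
    then have "finite R" using assms(1) by (auto intro: finite_subset)
    then show "(-1) ^ card (toggle p R) = - ((-1) ^ card R :: real)"
      by (simp add: minus_one_power_iff even_card_toggle)
  qed
  finally show ?thesis by (simp add: sum_negf)
qed

text \<open>The spectral sensitivity of a function of full degree on \<open>S\<close> is at least \<open>sqrt (card S)\<close>:
  since \<open>g\<close> correlates with parity, one of the classes of \<open>g R = even (card R)\<close> is a strict
  majority of the cube, and all its edges are sensitive.\<close>

lemma sensitive_weights:
  fixes g :: "nat set \<Rightarrow> bool"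
  assumes S: "finite S" "S \<noteq> {}" and full: "(\<Sum>R\<in>Pow S. (-1) ^ card R * bit (g R)) \<noteq> 0"
  obtains w where "\<And>R. w R \<ge> 0" "(\<Sum>R\<in>Pow S. (w R)\<^sup>2) > 0"
    "\<And>R i. R \<subseteq> S \<Longrightarrow> i \<in> S \<Longrightarrow> w R * w (toggle i R) \<noteq> 0 \<Longrightarrow> g R \<noteq> g (toggle i R)"
    "sqrt (card S) * (\<Sum>R\<in>Pow S. (w R)\<^sup>2) \<le> (\<Sum>R\<in>Pow S. \<Sum>i\<in>S. w R * w (toggle i R))"
proof -
  define H where "H b = {R\<in>Pow S. (g R = even (card R)) = b}" for b
  \<comment> \<open>Constants are orthogonal to parity, so passing to values 1 and -1 keeps the
    correlation nonzero; the sum then equals the size of \<open>H True\<close> minus that of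
    \<open>H False\<close>.\<close>
  have "(\<Sum>R\<in>Pow S. (-1) ^ card R * (2 * bit (g R) - 1)) \<noteq> 0"
    using full sum_minus_one_power_card_Pow[OF S]
    by (simp add: right_diff_distrib sum_subtractf mult.left_commute[of _ 2] flip: sum_distrib_left)
  moreover have "(\<Sum>R\<in>Pow S. (-1) ^ card R * (2 * bit (g R) - 1)) =
      (\<Sum>R\<in>Pow S. if R \<in> H True then 1 else 0 :: real) - (\<Sum>R\<in>Pow S. if R \<in> H False then 1 else 0)"
    unfolding sum_subtractf[symmetric]
    by (intro sum.cong) (auto simp: H_def bit_def minus_one_power_iff)
  moreover have "(\<Sum>R\<in>Pow S. if R \<in> H b then 1 else 0 :: real) = card (H b)" for b
  proof -
    have "{R \<in> Pow S. R \<in> H b} = H b" by (auto simp: H_def)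
    then show ?thesis using S by (simp add: sum.If_cases Int_def)
  qed
  ultimately have ne: "card (H True) \<noteq> card (H False)" by simp
  have "card (H True) + card (H False) = card (H True \<union> H False)"
    using S by (intro card_Un_disjoint[symmetric]) (auto simp: H_def)
  also have "H True \<union> H False = Pow S" by (auto simp: H_def)
  finally have "card (H True) + card (H False) = 2 ^ card S"
    using S by (simp add: card_Pow)
  with ne have "2 ^ card S < 2 * card (H True) \<or> 2 ^ card S < 2 * card (H False)"
    by linarith
  then obtain b where "2 ^ card S < 2 * card (H b)" by blast
  moreover have "H b \<subseteq> Pow S" by (auto simp: H_def)
  note eigenvector_supported_on_majority[OF S(1) this]
  ultimately obtain v where v: "\<And>R. R \<subseteq> S \<Longrightarrow> signed_adj S v R = sqrt (card S) * v R"
    "\<And>R. R \<in> Pow S - H b \<Longrightarrow> v R = 0" "\<exists>R\<in>Pow S. v R \<noteq> 0" by metis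
  show thesis
  proof (rule that[of "\<lambda>R. \<bar>v R\<bar>"])
    obtain R where "R \<in> Pow S" "v R \<noteq> 0" using v(3) by auto
    then show "0 < (\<Sum>R\<in>Pow S. \<bar>v R\<bar>\<^sup>2)"
      using S by (intro sum_pos2[of _ R]) auto
    show "g R \<noteq> g (toggle i R)" if "R \<subseteq> S" "i \<in> S" "\<bar>v R\<bar> * \<bar>v (toggle i R)\<bar> \<noteq> 0" for R i
    proof -
      have "v R \<noteq> 0" "v (toggle i R) \<noteq> 0" using that(3) by auto
      then have "R \<in> H b" "toggle i R \<in> H b"
        using v(2) that(1,2) toggle_subset[of i S R] by blast+
      moreover have "finite R" using S(1) that(1) by (rule rev_finite_subset)
      \<comment> \<open>Both endpoints lie in the same class but differ in parity, so
        \<open>g\<close> changes along the edge.\<close>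
      ultimately show ?thesis using even_card_toggle[of R i] unfolding H_def by blast
    qed
    have "sqrt (card S) * \<bar>v R\<bar>\<^sup>2 \<le> (\<Sum>i\<in>S. \<bar>v R\<bar> * \<bar>v (toggle i R)\<bar>)" if "R \<in> Pow S" for R
    proof -
      \<comment> \<open>The eigenvalue equation is multiplied by \<open>v R\<close>; dropping all
        signs can only increase its other side.\<close>
      have "sqrt (card S) * \<bar>v R\<bar>\<^sup>2 = v R * signed_adj S v R"
        using that by (simp add: v(1) power2_eq_square)
      also have "\<dots> = (\<Sum>i\<in>S. v R * (edge_sign i R * v (toggle i R)))"
        by (simp add: signed_adj_def sum_distrib_left)
      also have "\<dots> \<le> (\<Sum>i\<in>S. \<bar>v R\<bar> * \<bar>v (toggle i R)\<bar>)"
      proof (rule sum_mono)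
        fix i
        show "v R * (edge_sign i R * v (toggle i R)) \<le> \<bar>v R\<bar> * \<bar>v (toggle i R)\<bar>"
          using abs_ge_self[of "v R * (edge_sign i R * v (toggle i R))"] by (simp add: abs_mult)
      qed
      finally show ?thesis .
    qed
    then show "sqrt (card S) * (\<Sum>R\<in>Pow S. \<bar>v R\<bar>\<^sup>2) \<le> (\<Sum>R\<in>Pow S. \<Sum>i\<in>S. \<bar>v R\<bar> * \<bar>v (toggle i R)\<bar>)"
      unfolding sum_distrib_left by (intro sum_mono) auto
  qed auto
qed

section \<open>Degree\<close>

definition indicator_list :: "nat \<Rightarrow> nat set \<Rightarrow> bool list" where
  "indicator_list n R = map (\<lambda>i. i \<in> R) [0..<n]"

lemma length_indicator_list [simp]: "length (indicator_list n R) = n"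
  by (simp add: indicator_list_def)

lemma nth_indicator_list [simp]: "i < n \<Longrightarrow> indicator_list n R ! i \<longleftrightarrow> i \<in> R"
  by (simp add: indicator_list_def)

lemma indicator_list_in_bool_inputs [simp]: "indicator_list n R \<in> bool_inputs n"
  by (simp add: bool_inputs_def)

lemma bool_inputs_indicator_listE:
  assumes "x \<in> bool_inputs n"
  obtains R where "R \<subseteq> {..<n}" "x = indicator_list n R"
proof
  show "x = indicator_list n {i. i < n \<and> x ! i}"
    using assms by (auto simp: bool_inputs_def intro!: nth_equalityI)
qed auto

text \<open>On the indicator of \<open>R\<close> the monomial of \<open>S\<close> is 1 if
  \<open>S \<subseteq> R\<close> and 0 otherwise, so evaluation is the zeta transform of the
  coefficients on the subset lattice.\<close>

lemma multilinear_rep_iff: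
  "multilinear_rep n c f \<longleftrightarrow> (\<forall>R\<subseteq>{..<n}. bit (f (indicator_list n R)) = sum c (Pow R))"
proof -
  have "(\<Sum>S\<in>Pow {..<n}. c S * (\<Prod>i\<in>S. bit (indicator_list n R ! i))) = sum c (Pow R)"
    if R: "R \<subseteq> {..<n}" for R
  proof -
    have prod: "(\<Prod>i\<in>S. bit (indicator_list n R ! i)) = (if S \<subseteq> R then 1 else 0)"
      if "S \<subseteq> {..<n}" for S
    proof -
      have "(\<Prod>i\<in>S. bit (indicator_list n R ! i)) = (\<Prod>i\<in>S. bit (i \<in> R))"
        using that by (intro prod.cong) auto
      moreover have "finite S" using that by (auto intro: finite_subset)
      ultimately show ?thesis by (auto simp: bit_def intro!: prod.neutral)
    qed
    have "(\<Sum>S\<in>Pow {..<n}. c S * (\<Prod>i\<in>S. bit (indicator_list n R ! i))) =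
        (\<Sum>S\<in>Pow {..<n}. if S \<in> Pow R then c S else 0)"
      by (intro sum.cong) (auto simp: prod)
    also have "\<dots> = sum c (Pow {..<n} \<inter> Pow R)"
      by (simp add: sum.inter_restrict)
    also have "Pow {..<n} \<inter> Pow R = Pow R" using R by auto
    finally show ?thesis .
  qed
  moreover have "bool_inputs n = indicator_list n ` Pow {..<n}"
    by (auto elim: bool_inputs_indicator_listE)
  ultimately show ?thesis
    by (auto simp: multilinear_rep_def)
qed

text \<open>Moebius inversion of that transform. It makes the coefficients unique and turns a
  nonzero one at \<open>S\<close> into a correlation of \<open>f\<close> with parity on the subcube
  of \<open>S\<close>.\<close>

lemma multilinear_rep_coeff:
  assumes "multilinear_rep n c f" "S \<subseteq> {..<n}"
  shows "c S = (-1) ^ card S * (\<Sum>R\<in>Pow S. (-1) ^ card R * bit (f (indicator_list n R)))"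
proof -
  have S: "finite S" using assms(2) by (auto intro: finite_subset)
  have "c S = (\<Sum>R\<in>Pow S. (-1) ^ (card S - card R) * sum c (Pow R))"
    using S by (intro inclusion_exclusion_mobius) auto
  also have "\<dots> = (\<Sum>R\<in>Pow S. (-1) ^ card S * ((-1) ^ card R * bit (f (indicator_list n R))))"
  proof (intro sum.cong refl)
    fix R assume "R \<in> Pow S"
    then have "card R \<le> card S" "R \<subseteq> {..<n}" using S assms(2) card_mono by auto
    then show "(-1) ^ (card S - card R) * sum c (Pow R) =
        (-1) ^ card S * ((-1) ^ card R * bit (f (indicator_list n R)))"
      using assms(1) by (auto simp: multilinear_rep_iff minus_one_power_iff)
  qed
  finally show ?thesis by (simp add: sum_distrib_left)
qed

text \<open>The signed subset sum is its own inverse, so coefficients defined by the Moebius formula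
  do represent \<open>f\<close>.\<close>

lemma multilinear_rep_exists: "\<exists>c. multilinear_rep n c f"
proof -
  define b where "b R = bit (f (indicator_list n R))" for R
  define c where "c S = (-1) ^ card S * (\<Sum>R\<in>Pow S. (-1) ^ card R * b R)" for S :: "nat set"
  have "b R = sum c (Pow R)" if "finite R" for R
    unfolding c_def by (rule inclusion_exclusion_symmetric[OF refl that])
  then show ?thesis
    by (intro exI[of _ c]) (auto simp: multilinear_rep_iff b_def finite_subset)
qed

text \<open>The \<open>THE\<close> in \<open>bdeg\<close> is resolved by existence and uniqueness of
  the normalised representation. A nonzero maximum is then attained by a monomial, whose coefficient
  is the parity sum up to sign.\<close>

lemma bdeg_witness:
  assumes "bdeg n f \<noteq> 0"
  obtains S where "S \<subseteq> {..<n}" "card S = bdeg n f"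
    "(\<Sum>R\<in>Pow S. (-1) ^ card R * bit (f (indicator_list n R))) \<noteq> 0"
proof -
  define P where "P c \<longleftrightarrow> multilinear_rep n c f \<and> (\<forall>S. \<not> S \<subseteq> {..<n} \<longrightarrow> c S = 0)" for c
  obtain c0 where c0: "multilinear_rep n c0 f" using multilinear_rep_exists by blast
  define c1 where "c1 S = (if S \<subseteq> {..<n} then c0 S else 0)" for S
  have "sum c1 (Pow R) = sum c0 (Pow R)" if "R \<subseteq> {..<n}" for R
    using that by (intro sum.cong) (auto simp: c1_def)
  then have "P c1" using c0 by (auto simp: P_def multilinear_rep_iff c1_def)
  moreover have "c = c'" if "P c" "P c'" for c c'
  proof
    fix S show "c S = c' S"
      using that multilinear_rep_coeff[of n c f S] multilinear_rep_coeff[of n c' f S]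
      by (cases "S \<subseteq> {..<n}") (auto simp: P_def)
  qed
  ultimately have P: "P (THE c. P c)" by (intro theI[of P c1]) auto
  define c where "c = (THE c. P c)"
  define D where "D = {card S | S. S \<subseteq> {..<n} \<and> c S \<noteq> 0}"
  have bdeg: "bdeg n f = Max ({0} \<union> D)"
    by (simp add: bdeg_def multilinear_degree_def D_def c_def P_def)
  have "D \<subseteq> card ` Pow {..<n}" by (auto simp: D_def)
  then have "finite D" by (rule finite_subset) auto
  then have "Max ({0} \<union> D) \<in> {0} \<union> D" by (intro Max_in) auto
  with bdeg assms have "bdeg n f \<in> D" by auto
  then obtain S where "S \<subseteq> {..<n}" "card S = bdeg n f" "c S \<noteq> 0" by (auto simp: D_def)
  then show thesis using that[of S] multilinear_rep_coeff[of n c f S] P by (auto simp: P_def c_def)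
qed

section \<open>The adversary bound\<close>

definition vinner :: "nat \<Rightarrow> complex vec \<Rightarrow> complex vec \<Rightarrow> complex" where
  "vinner N v w = (\<Sum>k<N. v $ k * cnj (w $ k))"

text \<open>Orthonormality of the columns is the form in which unitarity is both exploited and
  checked below.\<close>

lemma unitary_mat_iff:
  "unitary_mat N U \<longleftrightarrow> U \<in> carrier_mat N N \<and>
     (\<forall>i<N. \<forall>j<N. (\<Sum>k<N. cnj (U $$ (k, i)) * U $$ (k, j)) = (if i = j then 1 else 0))"
proof (cases "U \<in> carrier_mat N N")
  case U: True
  have "(mat_adjoint U * U) $$ (i, j) = (\<Sum>k<N. cnj (U $$ (k, i)) * U $$ (k, j))"
    if "i < N" "j < N" for i j
    using U that by (simp add: mat_adjoint_def mat_of_rows_def scalar_prod_def lessThan_atLeast0)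
  moreover have "mat_adjoint U \<in> carrier_mat N N" using U by (auto simp: mat_adjoint_def intro!: carrier_matI)
  ultimately show ?thesis using U
    by (simp add: unitary_mat_def mat_eq_iff one_mat_def)
qed (simp add: unitary_mat_def)

lemma index_mult_mat_vec_sum:
  fixes U :: "complex mat"
  assumes "U \<in> carrier_mat N N" "v \<in> carrier_vec N" "k < N"
  shows "(U *\<^sub>v v) $ k = (\<Sum>i<N. U $$ (k, i) * v $ i)"
  using assms by (simp add: scalar_prod_def lessThan_atLeast0)

lemma vinner_unitary:
  assumes U: "unitary_mat N U" and v: "v \<in> carrier_vec N" and w: "w \<in> carrier_vec N"
  shows "vinner N (U *\<^sub>v v) (U *\<^sub>v w) = vinner N v w"
proof -
  have carrier: "U \<in> carrier_mat N N" using U by (simp add: unitary_mat_def)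
  have "vinner N (U *\<^sub>v v) (U *\<^sub>v w) =
      (\<Sum>k<N. (\<Sum>i<N. U $$ (k, i) * v $ i) * cnj (\<Sum>j<N. U $$ (k, j) * w $ j))"
    unfolding vinner_def
    by (intro sum.cong refl) (simp only: index_mult_mat_vec_sum[OF carrier v] index_mult_mat_vec_sum[OF carrier w] lessThan_iff)
  also have "\<dots> = (\<Sum>k<N. \<Sum>i<N. \<Sum>j<N. v $ i * cnj (w $ j) * (cnj (U $$ (k, j)) * U $$ (k, i)))"
    by (simp add: sum_product cnj_sum mult_ac)
  also have "\<dots> = (\<Sum>i<N. \<Sum>k<N. \<Sum>j<N. v $ i * cnj (w $ j) * (cnj (U $$ (k, j)) * U $$ (k, i)))"
    by (rule sum.swap)
  also have "\<dots> = (\<Sum>i<N. \<Sum>j<N. \<Sum>k<N. v $ i * cnj (w $ j) * (cnj (U $$ (k, j)) * U $$ (k, i)))"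
    by (intro sum.cong refl sum.swap)
  also have "\<dots> = (\<Sum>i<N. \<Sum>j<N. v $ i * cnj (w $ j) * (if j = i then 1 else 0))"
    using U unfolding sum_distrib_left[symmetric] by (intro sum.cong refl) (simp add: unitary_mat_iff)
  also have "\<dots> = vinner N v w"
    by (simp add: vinner_def if_distrib[of "(*) _"] cong: if_cong)
  finally show ?thesis .
qed

lemma query_op_carrier [simp]: "query_op n N x \<in> carrier_mat N N"
  by (simp add: query_op_def)

lemma query_op_mult_vec [simp]:
  assumes "v \<in> carrier_vec N" "k < N"
  shows "(query_op n N x *\<^sub>v v) $ k =
     (if k mod (n + 1) \<noteq> 0 \<and> x ! (k mod (n + 1) - 1) then - (v $ k) else v $ k)"
proof -
  have "(query_op n N x *\<^sub>v v) $ k = (\<Sum>l<N. query_op n N x $$ (k, l) * v $ l)"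
    using assms by (intro index_mult_mat_vec_sum) auto
  also have "\<dots> = (\<Sum>l<N. if l = k then
      (if k mod (n + 1) \<noteq> 0 \<and> x ! (k mod (n + 1) - 1) then - (v $ k) else v $ k) else 0)"
    using assms by (intro sum.cong) (auto simp: query_op_def Let_def)
  finally show ?thesis using assms by simp
qed

abbreviation query_step :: "nat \<Rightarrow> nat \<Rightarrow> bool list \<Rightarrow> complex vec \<Rightarrow> complex mat \<Rightarrow> complex vec" where
  "query_step n N x \<equiv> \<lambda>v U. U *\<^sub>v (query_op n N x *\<^sub>v v)"

lemma query_step_carrier:
  "unitary_mat N U \<Longrightarrow> v \<in> carrier_vec N \<Longrightarrow> query_step n N x v U \<in> carrier_vec N"
  by (auto simp: unitary_mat_def intro!: mult_mat_vec_carrier)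

lemma vinner_query_step:
  assumes "unitary_mat N U" "v \<in> carrier_vec N" "w \<in> carrier_vec N"
  shows "vinner N (query_step n N x v U) (query_step n N y w U)
    = vinner N (query_op n N x *\<^sub>v v) (query_op n N y *\<^sub>v w)"
  using assms by (intro vinner_unitary) (auto intro!: mult_mat_vec_carrier)

lemma vinner_query_op_self:
  assumes "v \<in> carrier_vec N"
  shows "vinner N (query_op n N x *\<^sub>v v) (query_op n N x *\<^sub>v v) = vinner N v v"
  unfolding vinner_def using assms by (intro sum.cong) auto

lemma vinner_self: "vinner N v v = of_real (\<Sum>k<N. (cmod (v $ k))\<^sup>2)"
  unfolding vinner_def of_real_sum complex_norm_square ..

text \<open>The two inputs differ in bit \<open>i\<close> only, so the query phases cancel in the
  product except where the register asks for bit \<open>i\<close>; there exactly one factor changes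
  sign.\<close>

lemma vinner_query_op_toggle:
  assumes v: "v \<in> carrier_vec N" "w \<in> carrier_vec N" and "i < n"
  shows "vinner N v w - vinner N (query_op n N (indicator_list n R) *\<^sub>v v)
      (query_op n N (indicator_list n (toggle i R)) *\<^sub>v w)
    = 2 * (\<Sum>k | k < N \<and> k mod (n + 1) = i + 1. v $ k * cnj (w $ k))"
proof -
  have "vinner N v w - vinner N (query_op n N (indicator_list n R) *\<^sub>v v)
      (query_op n N (indicator_list n (toggle i R)) *\<^sub>v w)
    = (\<Sum>k<N. if k mod (n + 1) = i + 1 then 2 * (v $ k * cnj (w $ k)) else 0)"
    unfolding vinner_def sum_subtractf[symmetric]
  proof (intro sum.cong refl)
    fix k assume "k \<in> {..<N}"
    then have k: "k < N" by simp
    define q where "q = k mod (n + 1)"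
    have "q < n + 1" by (simp add: q_def)
    then have "q - 1 < n \<or> q = 0" by auto
    then show "v $ k * cnj (w $ k) - (query_op n N (indicator_list n R) *\<^sub>v v) $ k *
        cnj ((query_op n N (indicator_list n (toggle i R)) *\<^sub>v w) $ k)
      = (if k mod (n + 1) = i + 1 then 2 * (v $ k * cnj (w $ k)) else 0)"
      unfolding query_op_mult_vec[OF v(1) k] query_op_mult_vec[OF v(2) k] q_def[symmetric]
      by (cases "q = 0"; cases "q = i + 1") (auto simp: mem_toggle)
  qed
  also have "\<dots> = (\<Sum>k | k < N \<and> k mod (n + 1) = i + 1. 2 * (v $ k * cnj (w $ k)))"
    by (subst sum.inter_filter[symmetric]) auto
  finally show ?thesis by (simp add: sum_distrib_left)
qed

section \<open>Query magnitudes and the loss of progress per query\<close>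

definition block_weight :: "nat \<Rightarrow> nat \<Rightarrow> nat \<Rightarrow> complex vec \<Rightarrow> real" where
  "block_weight n N i v = (\<Sum>k | k < N \<and> k mod (n + 1) = i + 1. (cmod (v $ k))\<^sup>2)"

lemma sum_block_weight_le:
  assumes "finite S"
  shows "(\<Sum>i\<in>S. block_weight n N i v) \<le> Re (vinner N v v)"
proof -
  have "(\<Sum>i\<in>S. block_weight n N i v) =
      (\<Sum>k\<in>(\<Union>i\<in>S. {k. k < N \<and> k mod (n + 1) = i + 1}). (cmod (v $ k))\<^sup>2)"
    unfolding block_weight_def using assms by (intro sum.UNION_disjoint[symmetric]) auto
  also have "\<dots> \<le> (\<Sum>k<N. (cmod (v $ k))\<^sup>2)"
    by (intro sum_mono2) auto
  finally show ?thesis by (simp add: vinner_self)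
qed

text \<open>The potential of the weighted adversary method. Every edge is counted from both of its
  endpoints.\<close>

definition progress :: "nat \<Rightarrow> nat set \<Rightarrow> (nat set \<Rightarrow> real) \<Rightarrow> (nat set \<Rightarrow> complex vec) \<Rightarrow> real" where
  "progress N S w \<psi> = (\<Sum>R\<in>Pow S. \<Sum>i\<in>S. w R * w (toggle i R) * Re (vinner N (\<psi> R) (\<psi> (toggle i R))))"

text \<open>The unitary preserves overlaps, so an edge in direction \<open>i\<close> loses only
  through amplitudes querying bit \<open>i\<close>. AM-GM charges this loss to the query magnitudes
  at the two endpoints, whence the factor 2; over all \<open>i\<close> the magnitudes of one state
  sum to at most 1.\<close>

lemma progress_query_step:
  assumes S: "finite S" "S \<subseteq> {..<n}" and U: "unitary_mat N U"
    and w: "\<And>R. w R \<ge> 0"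
    and \<psi>: "\<And>R. \<psi> R \<in> carrier_vec N" "\<And>R. vinner N (\<psi> R) (\<psi> R) = 1"
  shows "progress N S w \<psi> - progress N S w (\<lambda>R. query_step n N (indicator_list n R) (\<psi> R) U)
    \<le> 2 * (\<Sum>R\<in>Pow S. (w R)\<^sup>2)"
proof -
  let ?x = "indicator_list n"
  define h where "h i R = (w R)\<^sup>2 * block_weight n N i (\<psi> R)" for i R
  have edge: "w R * w (toggle i R) * (Re (vinner N (\<psi> R) (\<psi> (toggle i R)))
      - Re (vinner N (query_step n N (?x R) (\<psi> R) U) (query_step n N (?x (toggle i R)) (\<psi> (toggle i R)) U)))
    \<le> h i R + h i (toggle i R)" if "i \<in> S" for i R
  proof -
    define R' where "R' = toggle i R"
    define K where "K = {k. k < N \<and> k mod (n + 1) = i + 1}"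
    have "i < n" using that S by auto
    then have "Re (vinner N (\<psi> R) (\<psi> R')) - Re (vinner N (query_step n N (?x R) (\<psi> R) U)
        (query_step n N (?x R') (\<psi> R') U)) = (\<Sum>k\<in>K. 2 * Re (\<psi> R $ k * cnj (\<psi> R' $ k)))"
      using arg_cong[OF vinner_query_op_toggle[OF \<psi>(1)[of R] \<psi>(1)[of "toggle i R"], of i n R], of Re]
      by (simp add: vinner_query_step[OF U \<psi>(1) \<psi>(1)] R'_def K_def sum_distrib_left)
    then have "w R * w R' * (Re (vinner N (\<psi> R) (\<psi> R')) - Re (vinner N (query_step n N (?x R) (\<psi> R) U)
        (query_step n N (?x R') (\<psi> R') U))) = (\<Sum>k\<in>K. w R * w R' * (2 * Re (\<psi> R $ k * cnj (\<psi> R' $ k))))"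
      by (simp only: sum_distrib_left)
    also have "\<dots> \<le> (\<Sum>k\<in>K. (w R)\<^sup>2 * (cmod (\<psi> R $ k))\<^sup>2 + (w R')\<^sup>2 * (cmod (\<psi> R' $ k))\<^sup>2)"
    proof (rule sum_mono)
      fix k
      have "w R * w R' * (2 * Re (\<psi> R $ k * cnj (\<psi> R' $ k)))
          \<le> w R * w R' * (2 * (cmod (\<psi> R $ k) * cmod (\<psi> R' $ k)))"
        using w complex_Re_le_cmod[of "\<psi> R $ k * cnj (\<psi> R' $ k)"]
        by (intro mult_left_mono) (auto simp: norm_mult)
      also have "\<dots> = 2 * (w R * cmod (\<psi> R $ k)) * (w R' * cmod (\<psi> R' $ k))" by simp
      also have "\<dots> \<le> (w R * cmod (\<psi> R $ k))\<^sup>2 + (w R' * cmod (\<psi> R' $ k))\<^sup>2"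
        by (rule sum_squares_bound)
      finally show "w R * w R' * (2 * Re (\<psi> R $ k * cnj (\<psi> R' $ k)))
          \<le> (w R)\<^sup>2 * (cmod (\<psi> R $ k))\<^sup>2 + (w R')\<^sup>2 * (cmod (\<psi> R' $ k))\<^sup>2"
        by (simp add: power_mult_distrib)
    qed
    also have "\<dots> = h i R + h i R'"
      by (simp add: h_def block_weight_def K_def sum.distrib sum_distrib_left)
    finally show ?thesis by (simp add: R'_def)
  qed
  have "progress N S w \<psi> - progress N S w (\<lambda>R. query_step n N (?x R) (\<psi> R) U)
      \<le> (\<Sum>R\<in>Pow S. \<Sum>i\<in>S. h i R + h i (toggle i R))"
    unfolding progress_def sum_subtractf[symmetric] right_diff_distrib[symmetric]
    by (intro sum_mono edge)
  also have "\<dots> = (\<Sum>i\<in>S. \<Sum>R\<in>Pow S. h i R + h i (toggle i R))"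
    by (rule sum.swap)
  also have "\<dots> = (\<Sum>i\<in>S. 2 * (\<Sum>R\<in>Pow S. h i R))"
  proof (rule sum.cong)
    fix i assume "i \<in> S"
    then have "(\<Sum>R\<in>Pow S. h i (toggle i R)) = (\<Sum>R\<in>Pow S. h i R)"
      by (intro sum.reindex_bij_betw bij_betw_toggle_Pow)
    then show "(\<Sum>R\<in>Pow S. h i R + h i (toggle i R)) = 2 * (\<Sum>R\<in>Pow S. h i R)"
      by (simp add: sum.distrib)
  qed simp
  also have "\<dots> = 2 * (\<Sum>R\<in>Pow S. (w R)\<^sup>2 * (\<Sum>i\<in>S. block_weight n N i (\<psi> R)))"
    unfolding sum_distrib_left h_def by (rule sum.swap)
  also have "\<dots> \<le> 2 * (\<Sum>R\<in>Pow S. (w R)\<^sup>2 * 1)"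
  proof (intro mult_left_mono sum_mono)
    fix R
    show "(\<Sum>i\<in>S. block_weight n N i (\<psi> R)) \<le> 1"
      using sum_block_weight_le[OF S(1), of n N "\<psi> R"] by (simp add: \<psi>(2))
  qed auto
  finally show ?thesis by simp
qed

lemma query_steps_state:
  assumes "\<forall>U\<in>set Us. unitary_mat N U" "v \<in> carrier_vec N" "vinner N v v = 1"
  shows "foldl (query_step n N x) v Us \<in> carrier_vec N \<and>
    vinner N (foldl (query_step n N x) v Us) (foldl (query_step n N x) v Us) = 1"
  using assms
proof (induction Us arbitrary: v)
  case (Cons U Us)
  have "vinner N (query_step n N x v U) (query_step n N x v U) = 1"
    using Cons.prems by (simp add: vinner_query_step vinner_query_op_self)
  moreover have "query_step n N x v U \<in> carrier_vec N"
    using Cons.prems by (intro query_step_carrier) auto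
  ultimately show ?case using Cons.IH[of "query_step n N x v U"] Cons.prems by simp
qed simp

lemma progress_query_steps:
  fixes w :: "nat set \<Rightarrow> real"
  assumes S: "finite S" "S \<subseteq> {..<n}" and U: "\<forall>U\<in>set Us. unitary_mat N U"
    and w: "\<And>R. w R \<ge> 0"
    and \<psi>: "\<And>R. \<psi> R \<in> carrier_vec N" "\<And>R. vinner N (\<psi> R) (\<psi> R) = 1"
  shows "progress N S w \<psi> - progress N S w (\<lambda>R. foldl (query_step n N (indicator_list n R)) (\<psi> R) Us)
    \<le> 2 * length Us * (\<Sum>R\<in>Pow S. (w R)\<^sup>2)"
  using U \<psi>
proof (induction Us arbitrary: \<psi>)
  case (Cons U Us)
  define \<phi> where "\<phi> R = query_step n N (indicator_list n R) (\<psi> R) U" for R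
  have U: "unitary_mat N U" "\<forall>U\<in>set Us. unitary_mat N U" using Cons.prems(1) by auto
  have "progress N S w \<phi> - progress N S w (\<lambda>R. foldl (query_step n N (indicator_list n R)) (\<phi> R) Us)
      \<le> 2 * length Us * (\<Sum>R\<in>Pow S. (w R)\<^sup>2)"
  proof (rule Cons.IH[OF U(2)])
    show "\<phi> R \<in> carrier_vec N" for R
      unfolding \<phi>_def using U Cons.prems by (intro query_step_carrier)
    show "vinner N (\<phi> R) (\<phi> R) = 1" for R
      unfolding \<phi>_def using U Cons.prems by (simp add: vinner_query_step vinner_query_op_self)
  qed
  moreover have "progress N S w \<psi> - progress N S w \<phi> \<le> 2 * (\<Sum>R\<in>Pow S. (w R)\<^sup>2)"
    unfolding \<phi>_def using Cons.prems by (intro progress_query_step S U w)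
  ultimately show ?case by (simp add: \<phi>_def algebra_simps)
qed simp

text \<open>Weighted AM-GM with ratio \<open>2/3\<close> in place of Cauchy-Schwarz, which would give the
  slightly better constant \<open>2 * sqrt 2 / 3\<close>.\<close>

lemma vinner_distinguishable:
  fixes v w :: "complex vec"
  assumes v: "vinner N v v = 1" and w: "vinner N w w = 1" and Acc: "Acc \<subseteq> {..<N}"
    and pv: "(\<Sum>k\<in>Acc. (cmod (v $ k))\<^sup>2) \<ge> 2/3" and pw: "(\<Sum>k\<in>Acc. (cmod (w $ k))\<^sup>2) \<le> 1/3"
  shows "cmod (vinner N v w) \<le> 17/18"
proof -
  let ?s = "\<lambda>u A. \<Sum>k\<in>A. (cmod (u $ k))\<^sup>2"
  have amgm1: "a * b \<le> a\<^sup>2 / 3 + 3 / 4 * b\<^sup>2" for a b :: real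
    using zero_le_power2[of "2 * a - 3 * b"] by (simp add: power2_eq_square algebra_simps)
  have amgm2: "a * b \<le> 3 / 4 * a\<^sup>2 + b\<^sup>2 / 3" for a b :: real
    using amgm1[of b a] by (simp add: mult.commute)
  have split: "sum g {..<N} = sum g Acc + sum g ({..<N} - Acc)" for g :: "nat \<Rightarrow> real"
    using Acc by (subst sum.subset_diff[of Acc]) auto
  have "(\<Sum>k<N. (cmod (v $ k))\<^sup>2) = 1"
    using v unfolding vinner_self of_real_eq_1_iff .
  moreover have "(\<Sum>k<N. (cmod (w $ k))\<^sup>2) = 1"
    using w unfolding vinner_self of_real_eq_1_iff .
  ultimately have one: "?s v Acc + ?s v ({..<N} - Acc) = 1" "?s w Acc + ?s w ({..<N} - Acc) = 1"
    by (simp_all only: split)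
  have "cmod (vinner N v w) \<le> (\<Sum>k<N. cmod (v $ k) * cmod (w $ k))"
    unfolding vinner_def by (rule order.trans[OF norm_sum]) (simp add: norm_mult)
  also have "\<dots> = (\<Sum>k\<in>Acc. cmod (v $ k) * cmod (w $ k)) + (\<Sum>k\<in>{..<N} - Acc. cmod (v $ k) * cmod (w $ k))"
    by (rule split)
  \<comment> \<open>On \<open>Acc\<close> the weight of \<open>w\<close> is the small one, off
    \<open>Acc\<close> that of \<open>v\<close>; the larger factor \<open>3/4\<close> goes to the
    small one.\<close>
  also have "\<dots> \<le> (\<Sum>k\<in>Acc. (cmod (v $ k))\<^sup>2 / 3 + 3 / 4 * (cmod (w $ k))\<^sup>2) +
      (\<Sum>k\<in>{..<N} - Acc. 3 / 4 * (cmod (v $ k))\<^sup>2 + (cmod (w $ k))\<^sup>2 / 3)"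
    by (intro add_mono sum_mono amgm1 amgm2)
  also have "\<dots> = ?s v Acc / 3 + 3 / 4 * ?s w Acc + (3 / 4 * ?s v ({..<N} - Acc) + ?s w ({..<N} - Acc) / 3)"
    by (simp add: sum.distrib sum_distrib_left sum_divide_distrib)
  \<comment> \<open>For acceptance probabilities \<open>p\<close> of \<open>v\<close> and
    \<open>q\<close> of \<open>w\<close> the sum is \<open>13/12 - 5/12 * (p - q)\<close>, and
    \<open>p - q \<ge> 1/3\<close>.\<close>
  also have "\<dots> \<le> 17/18" using one pv pw by linarith
  finally show ?thesis .
qed

lemma vinner_commute: "vinner N w v = cnj (vinner N v w)"
  by (simp add: vinner_def mult.commute)

lemma bdeg_le_queries:
  assumes "computes_bounded_error n T f"
  shows "real (bdeg n f) \<le> 1296 * (real T)\<^sup>2"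
proof (cases "bdeg n f = 0")
  case False
  let ?x = "indicator_list n"
  obtain S where S: "S \<subseteq> {..<n}" "card S = bdeg n f"
    and full: "(\<Sum>R\<in>Pow S. (-1) ^ card R * bit (f (?x R))) \<noteq> 0"
    using bdeg_witness[OF False] by blast
  have S': "finite S" "S \<noteq> {}" using S False by (auto intro: finite_subset)
  obtain w where w: "\<And>R. w R \<ge> 0" "(\<Sum>R\<in>Pow S. (w R)\<^sup>2) > 0"
    and sens: "\<And>R i. R \<subseteq> S \<Longrightarrow> i \<in> S \<Longrightarrow> w R * w (toggle i R) \<noteq> 0 \<Longrightarrow> f (?x R) \<noteq> f (?x (toggle i R))"
    and eig: "sqrt (card S) * (\<Sum>R\<in>Pow S. (w R)\<^sup>2) \<le> (\<Sum>R\<in>Pow S. \<Sum>i\<in>S. w R * w (toggle i R))"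
    using sensitive_weights[OF S' full] by blast
  define W where "W = (\<Sum>R\<in>Pow S. \<Sum>i\<in>S. w R * w (toggle i R))"
  obtain m Us Acc where m: "m \<ge> 1" and len: "length Us = T + 1"
    and U: "\<forall>U\<in>set Us. unitary_mat (m * (n + 1)) U" and Acc: "Acc \<subseteq> {..<m * (n + 1)}"
    and correct: "\<And>x. x \<in> bool_inputs n \<Longrightarrow> prob_correct n (m * (n + 1)) Us Acc f x \<ge> 2 / 3"
    using assms unfolding computes_bounded_error_def by blast
  define N where "N = m * (n + 1)"
  have "N > 0" using m by (simp add: N_def)
  \<comment> \<open>\<open>U0\<close> acts before any query: only the \<open>T\<close> unitaries in
    \<open>Us'\<close> follow one, and all inputs share the start state \<open>\<psi>0\<close>, so
    the initial progress is \<open>W\<close>.\<close>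
  obtain U0 Us' where Us: "Us = U0 # Us'" using len by (cases Us) auto
  have U0: "unitary_mat N U0" and Us': "\<forall>U\<in>set Us'. unitary_mat N U"
    using U by (auto simp: Us N_def)
  define \<psi>0 where "\<psi>0 = U0 *\<^sub>v unit_vec N 0"
  have \<psi>0: "\<psi>0 \<in> carrier_vec N"
    using U0 by (auto simp: \<psi>0_def unitary_mat_def intro!: mult_mat_vec_carrier)
  have "vinner N (unit_vec N 0) (unit_vec N 0) = 1"
    using \<open>N > 0\<close> by (simp add: vinner_def unit_vec_def if_distrib cong: if_cong)
  then have \<psi>0': "vinner N \<psi>0 \<psi>0 = 1"
    using U0 by (simp add: \<psi>0_def vinner_unitary)
  define \<psi> where "\<psi> R = foldl (query_step n N (?x R)) \<psi>0 Us'" for R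
  have final: "final_state n N Us (?x R) = \<psi> R" for R
    by (simp add: final_state_def Us \<psi>_def \<psi>0_def)
  have \<psi>: "vinner N (\<psi> R) (\<psi> R) = 1" for R
    unfolding \<psi>_def using query_steps_state[OF Us' \<psi>0 \<psi>0'] by blast
  have dist: "cmod (vinner N (\<psi> R) (\<psi> R')) \<le> 17/18" if "f (?x R)" "\<not> f (?x R')" for R R'
    using correct[of "?x R", folded N_def] correct[of "?x R'", folded N_def] that Acc[folded N_def]
    by (intro vinner_distinguishable[where Acc = Acc])
       (auto simp: \<psi> prob_correct_def prob_one_def final)
  have "progress N S w \<psi> \<le> 17/18 * W"
    unfolding progress_def W_def sum_distrib_left
  proof (intro sum_mono)
    fix R i assume R: "R \<in> Pow S" "i \<in> S"
    show "w R * w (toggle i R) * Re (vinner N (\<psi> R) (\<psi> (toggle i R))) \<le> 17/18 * (w R * w (toggle i R))"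
    proof (cases "w R * w (toggle i R) = 0")
      case False
      then have "f (?x R) \<noteq> f (?x (toggle i R))" using R sens by blast
      then have "cmod (vinner N (\<psi> R) (\<psi> (toggle i R))) \<le> 17/18"
        using dist[of R "toggle i R"] dist[of "toggle i R" R]
        by (cases "f (?x R)") (simp_all add: vinner_commute[of N "\<psi> R"])
      then have "Re (vinner N (\<psi> R) (\<psi> (toggle i R))) \<le> 17/18"
        using complex_Re_le_cmod order.trans by blast
      then have "w R * w (toggle i R) * Re (vinner N (\<psi> R) (\<psi> (toggle i R))) \<le> w R * w (toggle i R) * (17/18)"
        using w(1) by (intro mult_left_mono) auto
      then show ?thesis by (simp add: mult.commute)
    qed auto
  qed
  moreover have "progress N S w (\<lambda>_. \<psi>0) = W"
    by (simp add: progress_def W_def \<psi>0')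
  moreover have "progress N S w (\<lambda>_. \<psi>0) - progress N S w \<psi> \<le> 2 * length Us' * (\<Sum>R\<in>Pow S. (w R)\<^sup>2)"
    unfolding \<psi>_def by (rule progress_query_steps[OF S'(1) S(1) Us' w(1) \<psi>0 \<psi>0'])
  \<comment> \<open>The forced drop \<open>W - 17/18 * W\<close> is at most \<open>2 * T\<close>
    times the squared norm of \<open>w\<close>; hence \<open>36 = 2 * 18\<close>.\<close>
  ultimately have "W \<le> 36 * T * (\<Sum>R\<in>Pow S. (w R)\<^sup>2)"
    using len by (simp add: Us)
  with eig have "sqrt (card S) * (\<Sum>R\<in>Pow S. (w R)\<^sup>2) \<le> 36 * T * (\<Sum>R\<in>Pow S. (w R)\<^sup>2)"
    unfolding W_def by linarith
  then have "sqrt (bdeg n f) \<le> 36 * T" using w(2) by (simp add: S(2))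
  then have "(sqrt (bdeg n f))\<^sup>2 \<le> (36 * real T)\<^sup>2" by (intro power_mono) auto
  then show ?thesis by (simp add: power_mult_distrib)
qed simp

section \<open>Every Boolean function has a query algorithm\<close>

definition pair_mat :: "nat \<Rightarrow> (nat \<Rightarrow> nat) \<Rightarrow> (nat \<Rightarrow> real) \<Rightarrow> real \<Rightarrow> complex mat" where
  "pair_mat N \<pi> a b = mat N N (\<lambda>(k, l).
     if \<pi> k = k then (if l = k then 1 else 0)
     else if l = k then of_real (a k) else if l = \<pi> k then of_real b else 0)"

definition involution_below :: "nat \<Rightarrow> (nat \<Rightarrow> nat) \<Rightarrow> bool" where
  "involution_below N \<pi> \<longleftrightarrow> (\<forall>k<N. \<pi> k < N \<and> \<pi> (\<pi> k) = k)"

lemma pair_mat_carrier [simp]: "pair_mat N \<pi> a b \<in> carrier_mat N N"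
  by (simp add: pair_mat_def)

text \<open>On each pair swapped by \<open>\<pi>\<close> the matrix is a reflection with rows
  \<open>(a k, b)\<close> and \<open>(b, - a k)\<close>, and it fixes all other basis vectors. Both
  kinds of gates used below have this shape.\<close>

lemma unitary_pair_mat:
  assumes \<pi>: "involution_below N \<pi>"
    and ab: "\<And>k. k < N \<Longrightarrow> \<pi> k \<noteq> k \<Longrightarrow> (a k)\<^sup>2 + b\<^sup>2 = 1 \<and> a (\<pi> k) = - a k"
  shows "unitary_mat N (pair_mat N \<pi> a b)"
  unfolding unitary_mat_iff
proof (intro conjI allI impI)
  fix i j assume i: "i < N" and j: "j < N"
  let ?U = "pair_mat N \<pi> a b"
  have \<pi>i: "\<pi> i < N" "\<pi> (\<pi> i) = i" using \<pi> i by (auto simp: involution_below_def)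
  have "(\<Sum>k<N. cnj (?U $$ (k, i)) * ?U $$ (k, j)) = (\<Sum>k\<in>{i, \<pi> i}. cnj (?U $$ (k, i)) * ?U $$ (k, j))"
  proof (rule sum.mono_neutral_right)
    show "\<forall>k\<in>{..<N} - {i, \<pi> i}. cnj (?U $$ (k, i)) * ?U $$ (k, j) = 0"
    proof
      fix k assume k: "k \<in> {..<N} - {i, \<pi> i}"
      then have "\<pi> (\<pi> k) = k" using \<pi> by (auto simp: involution_below_def)
      then have "i \<noteq> \<pi> k" using k by auto
      then have "?U $$ (k, i) = 0" using k i by (simp add: pair_mat_def)
      then show "cnj (?U $$ (k, i)) * ?U $$ (k, j) = 0" by simp
    qed
  qed (use i \<pi>i in auto)
  also have "\<dots> = (if i = j then 1 else 0)"
  proof (cases "\<pi> i = i")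
    case False
    have "(of_real (a i) * of_real (a i) + of_real b * of_real b :: complex) = of_real ((a i)\<^sup>2 + b\<^sup>2)"
      by (simp add: power2_eq_square)
    also have "\<dots> = 1" using ab[OF i False] by simp
    finally show ?thesis using False i j \<pi>i ab[OF i False] by (auto simp: pair_mat_def)
  qed (use i j in \<open>simp add: pair_mat_def\<close>)
  finally show "(\<Sum>k<N. cnj (?U $$ (k, i)) * ?U $$ (k, j)) = (if i = j then 1 else 0)" .
qed simp

lemma pair_mat_mult_vec:
  assumes \<pi>: "involution_below N \<pi>" and v: "v \<in> carrier_vec N" and k: "k < N"
  shows "(pair_mat N \<pi> a b *\<^sub>v v) $ k =
    (if \<pi> k = k then v $ k else of_real (a k) * v $ k + of_real b * v $ (\<pi> k))"
proof -
  let ?U = "pair_mat N \<pi> a b"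
  have \<pi>k: "\<pi> k < N" "\<pi> (\<pi> k) = k" using \<pi> k by (auto simp: involution_below_def)
  have "(?U *\<^sub>v v) $ k = (\<Sum>l<N. ?U $$ (k, l) * v $ l)"
    using v k by (intro index_mult_mat_vec_sum) auto
  also have "\<dots> = (\<Sum>l\<in>{k, \<pi> k}. ?U $$ (k, l) * v $ l)"
    by (rule sum.mono_neutral_right) (use k \<pi>k in \<open>auto simp: pair_mat_def\<close>)
  finally show ?thesis using k \<pi>k by (cases "\<pi> k = k") (auto simp: pair_mat_def)
qed

text \<open>While a bit is being read the state lives on at most two basis vectors, so two
  amplitudes suffice to follow it.\<close>

definition two_point_vec :: "nat \<Rightarrow> nat \<Rightarrow> nat \<Rightarrow> complex \<Rightarrow> complex \<Rightarrow> complex vec" where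
  "two_point_vec N k l \<alpha> \<beta> = vec N (\<lambda>j. if j = k then \<alpha> else if j = l then \<beta> else 0)"

lemma two_point_vec_carrier [simp]: "two_point_vec N k l \<alpha> \<beta> \<in> carrier_vec N"
  by (simp add: two_point_vec_def)

lemma unit_vec_eq_two_point_vec:
  "k \<noteq> l \<Longrightarrow> unit_vec N k = two_point_vec N k l 1 0"
  "k \<noteq> l \<Longrightarrow> unit_vec N l = two_point_vec N k l 0 1"
  by (auto simp: two_point_vec_def unit_vec_def)

lemma pair_mat_two_point_vec:
  assumes \<pi>: "involution_below N \<pi>" and k: "k < N" "\<pi> k = l" "k \<noteq> l"
  shows "pair_mat N \<pi> a b *\<^sub>v two_point_vec N k l \<alpha> \<beta> =
    two_point_vec N k l (of_real (a k) * \<alpha> + of_real b * \<beta>) (of_real (a l) * \<beta> + of_real b * \<alpha>)"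
proof (rule eq_vecI)
  fix j assume "j < dim_vec (two_point_vec N k l (of_real (a k) * \<alpha> + of_real b * \<beta>) (of_real (a l) * \<beta> + of_real b * \<alpha>))"
  then have j: "j < N" by (simp add: two_point_vec_def)
  have l: "l < N" "\<pi> l = k" using \<pi> k by (auto simp: involution_below_def)
  have \<pi>j: "\<pi> j < N" "\<pi> (\<pi> j) = j" using \<pi> j by (auto simp: involution_below_def)
  show "(pair_mat N \<pi> a b *\<^sub>v two_point_vec N k l \<alpha> \<beta>) $ j =
    two_point_vec N k l (of_real (a k) * \<alpha> + of_real b * \<beta>) (of_real (a l) * \<beta> + of_real b * \<alpha>) $ j"
    unfolding pair_mat_mult_vec[OF \<pi> two_point_vec_carrier j]
    using j k l \<pi>j by (auto simp: two_point_vec_def)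
qed (simp add: two_point_vec_def pair_mat_def)

lemma pair_mat_unit_vec:
  assumes \<pi>: "involution_below N \<pi>" and k: "k < N" "\<pi> k = k"
  shows "pair_mat N \<pi> a b *\<^sub>v unit_vec N k = unit_vec N k"
proof (rule eq_vecI)
  fix j assume "j < dim_vec (unit_vec N k :: complex vec)"
  then have j: "j < N" by simp
  then have \<pi>j: "\<pi> j < N" "\<pi> (\<pi> j) = j" using \<pi> by (auto simp: involution_below_def)
  show "(pair_mat N \<pi> a b *\<^sub>v unit_vec N k) $ j = unit_vec N k $ j"
    unfolding pair_mat_mult_vec[OF \<pi> unit_vec_carrier j]
    using j k \<pi>j by (auto simp: unit_vec_def)
qed (simp add: pair_mat_def)

lemma query_op_two_point_vec:
  assumes "k mod (n + 1) = 0" "l mod (n + 1) = i + 1"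
  shows "query_op n N x *\<^sub>v two_point_vec N k l \<alpha> \<beta> = two_point_vec N k l \<alpha> (if x ! i then - \<beta> else \<beta>)"
proof (rule eq_vecI)
  fix j assume "j < dim_vec (two_point_vec N k l \<alpha> (if x ! i then - \<beta> else \<beta>))"
  then have j: "j < N" by (simp add: two_point_vec_def)
  show "(query_op n N x *\<^sub>v two_point_vec N k l \<alpha> \<beta>) $ j
      = two_point_vec N k l \<alpha> (if x ! i then - \<beta> else \<beta>) $ j"
    unfolding query_op_mult_vec[OF two_point_vec_carrier j]
    using j assms by (auto simp: two_point_vec_def)
qed (simp add: two_point_vec_def query_op_def)

definition query_swap :: "nat \<Rightarrow> nat \<Rightarrow> nat \<Rightarrow> nat" where
  "query_swap n i k = (if k mod (n + 1) = 0 then k + (i + 1)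
     else if k mod (n + 1) = i + 1 then k - (i + 1) else k)"

definition store_swap :: "nat \<Rightarrow> nat \<Rightarrow> nat \<Rightarrow> nat" where
  "store_swap n i k = (let w = k div (n + 1); q = k mod (n + 1) in
     if q = i + 1 \<and> w < 2 ^ i then (w + 2 ^ i) * (n + 1)
     else if q = 0 \<and> 2 ^ i \<le> w \<and> w < 2 ^ (i + 1) then (w - 2 ^ i) * (n + 1) + (i + 1)
     else k)"

lemma register_bound:
  assumes "w < m" "q < n + 1" shows "w * (n + 1) + q < m * (n + 1 :: nat)"
proof -
  have "w * (n + 1) + q < (w + 1) * (n + 1)" using assms by simp
  also have "\<dots> \<le> m * (n + 1)" using assms by (intro mult_le_mono1) auto
  finally show ?thesis .
qed

lemma register_div_mod:
  assumes "q < n + 1"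
  shows "(w * (n + 1) + q) div (n + 1) = (w :: nat)" "(w * (n + 1) + q) mod (n + 1) = q"
  using assms by (simp_all only: div_mult_self3 mod_mult_self3 div_less mod_less)

lemma register_cases:
  obtains w q where "k = w * (n + 1) + q" "q < n + 1" "k < m * (n + 1) \<Longrightarrow> w < (m :: nat)"
proof (rule that[of "k div (n + 1)" "k mod (n + 1)"])
  show "k < m * (n + 1) \<Longrightarrow> k div (n + 1) < m" by (rule less_mult_imp_div_less)
  show "k = k div (n + 1) * (n + 1) + k mod (n + 1)" by (simp only: div_mult_mod_eq)
qed simp

lemma query_swap_register:
  assumes "q < n + 1" "i < n"
  shows "query_swap n i (w * (n + 1) + q) =
    w * (n + 1) + (if q = 0 then i + 1 else if q = i + 1 then 0 else q)"
  using assms unfolding query_swap_def register_div_mod[OF assms(1)] by auto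

lemma store_swap_register:
  assumes "q < n + 1"
  shows "store_swap n i (w * (n + 1) + q) =
    (if q = i + 1 \<and> w < 2 ^ i then (w + 2 ^ i) * (n + 1) + 0
     else if q = 0 \<and> 2 ^ i \<le> w \<and> w < 2 ^ (i + 1) then (w - 2 ^ i) * (n + 1) + (i + 1)
     else w * (n + 1) + q)"
  unfolding store_swap_def Let_def register_div_mod[OF assms] by simp

lemma involution_query_swap:
  assumes "i < n"
  shows "involution_below (m * (n + 1)) (query_swap n i)"
  unfolding involution_below_def
proof (intro allI impI)
  fix k assume k: "k < m * (n + 1)"
  obtain w q where wq: "k = w * (n + 1) + q" "q < n + 1" "w < m"
    using register_cases[of k n m] k by blast
  define q' where "q' = (if q = 0 then i + 1 else if q = i + 1 then 0 else q)"
  have q': "q' < n + 1" using wq(2) assms by (simp add: q'_def)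
  have "query_swap n i k = w * (n + 1) + q'"
    unfolding wq(1) query_swap_register[OF wq(2) assms] q'_def ..
  moreover have "query_swap n i (w * (n + 1) + q') = k"
    unfolding query_swap_register[OF q' assms] wq(1) by (simp add: q'_def)
  ultimately show "query_swap n i k < m * (n + 1) \<and> query_swap n i (query_swap n i k) = k"
    using register_bound[OF wq(3) q'] by simp
qed

lemma involution_store_swap:
  assumes "i < n"
  shows "involution_below (2 ^ n * (n + 1)) (store_swap n i)"
  unfolding involution_below_def
proof (intro allI impI)
  fix k assume k: "k < 2 ^ n * (n + 1)"
  obtain w q where wq: "k = w * (n + 1) + q" "q < n + 1" "w < 2 ^ n"
    using register_cases[of k n "2 ^ n"] k by blast
  have pow: "(2::nat) ^ (i + 1) \<le> 2 ^ n" using assms by (intro power_increasing) auto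
  consider (a) "q = i + 1" "w < 2 ^ i" | (b) "q = 0" "2 ^ i \<le> w" "w < 2 ^ (i + 1)"
    | (c) "\<not> (q = i + 1 \<and> w < 2 ^ i)" "\<not> (q = 0 \<and> 2 ^ i \<le> w \<and> w < 2 ^ (i + 1))" by blast
  then show "store_swap n i k < 2 ^ n * (n + 1) \<and> store_swap n i (store_swap n i k) = k"
  proof cases
    case a
    have "store_swap n i k = (w + 2 ^ i) * (n + 1) + 0"
      unfolding wq(1) store_swap_register[OF wq(2)] using a by simp
    moreover have "store_swap n i ((w + 2 ^ i) * (n + 1) + 0) = k"
      unfolding wq(1) by (subst store_swap_register) (use a in auto)
    moreover have "(w + 2 ^ i) * (n + 1) + 0 < 2 ^ n * (n + 1)"
      using a pow by (intro register_bound) auto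
    ultimately show ?thesis by simp
  next
    case b
    have "store_swap n i k = (w - 2 ^ i) * (n + 1) + (i + 1)"
      unfolding wq(1) store_swap_register[OF wq(2)] using b by simp
    moreover have "store_swap n i ((w - 2 ^ i) * (n + 1) + (i + 1)) = k"
      unfolding wq(1) by (subst store_swap_register) (use b assms in auto)
    moreover have "(w - 2 ^ i) * (n + 1) + (i + 1) < 2 ^ n * (n + 1)"
      using wq(3) assms by (intro register_bound) auto
    ultimately show ?thesis by simp
  next
    case c
    have "store_swap n i k = k"
      unfolding wq(1) store_swap_register[OF wq(2)] using c by (simp only: if_False)
    then show ?thesis using k by simp
  qed
qed

text \<open>The Hadamard gate on the query registers \<open>0\<close> and \<open>i + 1\<close>; it
  turns the phase of a query into a change of register.\<close>

definition hadamard_mat :: "nat \<Rightarrow> nat \<Rightarrow> nat \<Rightarrow> complex mat" where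
  "hadamard_mat n N i = pair_mat N (query_swap n i)
     (\<lambda>k. if k mod (n + 1) = 0 then 1 / sqrt 2 else - 1 / sqrt 2) (1 / sqrt 2)"

text \<open>The sign cancels the phase picked up in the extra query made just before this step.\<close>

definition store_mat :: "nat \<Rightarrow> nat \<Rightarrow> nat \<Rightarrow> complex mat" where
  "store_mat n N i = pair_mat N (store_swap n i) (\<lambda>_. 0) (- 1)"

lemma unitary_hadamard_mat:
  assumes "i < n"
  shows "unitary_mat (m * (n + 1)) (hadamard_mat n (m * (n + 1)) i)"
  unfolding hadamard_mat_def
proof (rule unitary_pair_mat[OF involution_query_swap[OF assms]])
  fix k assume k: "k < m * (n + 1)" "query_swap n i k \<noteq> k"
  obtain w q where wq: "k = w * (n + 1) + q" "q < n + 1"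
    using register_cases[of k n m] by blast
  define q' where "q' = (if q = 0 then i + 1 else 0)"
  have "q = 0 \<or> q = i + 1"
    using k(2) unfolding wq(1) query_swap_register[OF wq(2) assms] by (auto split: if_splits)
  then have swap: "query_swap n i k = w * (n + 1) + q'"
    unfolding wq(1) query_swap_register[OF wq(2) assms] by (auto simp: q'_def)
  have q': "q' < n + 1" using assms by (simp add: q'_def)
  have m: "k mod (n + 1) = q" "query_swap n i k mod (n + 1) = q'"
    unfolding swap register_div_mod[OF q'] unfolding wq(1) register_div_mod[OF wq(2)] by simp_all
  show "(if k mod (n + 1) = 0 then 1 / sqrt 2 else - 1 / sqrt 2)\<^sup>2 + (1 / sqrt 2)\<^sup>2 = 1 \<and>
    (if query_swap n i k mod (n + 1) = 0 then 1 / sqrt 2 else - 1 / sqrt 2) =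
    - (if k mod (n + 1) = 0 then 1 / sqrt 2 else - 1 / sqrt 2)"
    unfolding m by (auto simp: q'_def power_divide)
qed

lemma unitary_store_mat:
  assumes "i < n"
  shows "unitary_mat (2 ^ n * (n + 1)) (store_mat n (2 ^ n * (n + 1)) i)"
  unfolding store_mat_def by (rule unitary_pair_mat[OF involution_store_swap[OF assms]]) simp

section \<open>Reading the input bit by bit\<close>

fun prefix_code :: "bool list \<Rightarrow> nat \<Rightarrow> nat" where
  "prefix_code x 0 = 0"
| "prefix_code x (Suc i) = prefix_code x i + (if x ! i then 2 ^ i else 0)"

lemma prefix_code_less: "prefix_code x i < 2 ^ i"
  by (induction i) auto

text \<open>The code is a binary numeral, least significant bit first. Its lower digits stay below
  \<open>2 ^ i\<close>, so the top digit can be read off and removed.\<close>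

lemma prefix_code_inj:
  "prefix_code x i = prefix_code y i \<Longrightarrow> j < i \<Longrightarrow> x ! j = y ! j"
proof (induction i)
  case (Suc i)
  have "x ! i = y ! i" "prefix_code x i = prefix_code y i"
    using Suc.prems(1) prefix_code_less[of x i] prefix_code_less[of y i] by (auto split: if_splits)
  with Suc show ?case by (auto simp: less_Suc_eq)
qed simp

text \<open>Starting in a basis state with idle query register, the first query is void, the second one
  is sandwiched between Hadamard transforms and writes \<open>x ! i\<close> into the query register,
  and the last step moves this bit into the workspace.\<close>

lemma read_bit:
  assumes i: "i < n" and N: "N = 2 ^ n * (n + 1)"
  shows "foldl (query_step n N x) (unit_vec N (prefix_code x i * (n + 1)))
      [hadamard_mat n N i, hadamard_mat n N i, store_mat n N i]
    = unit_vec N (prefix_code x (Suc i) * (n + 1))"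
proof -
  define w where "w = prefix_code x i"
  define k where "k = w * (n + 1)"
  define l where "l = w * (n + 1) + (i + 1)"
  define k' where "k' = (w + 2 ^ i) * (n + 1)"
  define r :: real where "r = 1 / sqrt 2"
  have r: "complex_of_real r * complex_of_real r = 1 / 2"
    unfolding of_real_mult[symmetric] by (simp add: r_def)
  have w: "w < 2 ^ i" by (simp add: w_def prefix_code_less)
  have pow: "(2::nat) ^ i + 2 ^ i \<le> 2 ^ n"
    using i power_increasing[of "Suc i" n "2::nat"] by simp
  have less: "k < N" "l < N" "k' < N"
    using register_bound[of w "2 ^ n" 0 n] register_bound[of w "2 ^ n" "i + 1" n]
      register_bound[of "w + 2 ^ i" "2 ^ n" 0 n] w pow i
    by (simp_all add: k_def l_def k'_def N)
  have kl: "k \<noteq> l" by (simp add: k_def l_def)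
  have mods: "k mod (n + 1) = 0" "l mod (n + 1) = i + 1" "k' mod (n + 1) = 0"
    using register_div_mod[of "i + 1" n w] i by (simp_all only: k_def l_def k'_def mod_mult_self2_is_0)
  then have lk': "l \<noteq> k'" by auto
  have inv: "involution_below N (query_swap n i)" "involution_below N (store_swap n i)"
    using involution_query_swap[OF i, of "2 ^ n"] involution_store_swap[OF i] by (simp_all add: N)
  have swap: "query_swap n i k = l"
    using query_swap_register[of 0 n i w] i by (simp add: k_def l_def)
  have store: "store_swap n i k = k" "store_swap n i l = k'"
    using store_swap_register[of 0 n i w] store_swap_register[of "i + 1" n i w] i w
    by (simp_all add: k_def l_def k'_def)
  have hadamard: "hadamard_mat n N i *\<^sub>v two_point_vec N k l \<alpha> \<beta> =
      two_point_vec N k l (of_real r * (\<alpha> + \<beta>)) (of_real r * (\<alpha> - \<beta>))" for \<alpha> \<beta>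
    unfolding hadamard_mat_def pair_mat_two_point_vec[OF inv(1) less(1) swap kl] mods
    by (simp add: r_def algebra_simps add_divide_distrib diff_divide_distrib)
  \<comment> \<open>The phase that one query puts on \<open>l\<close>.\<close>
  define s :: complex where "s = (if x ! i then - 1 else 1)"
  have query: "query_op n N x *\<^sub>v two_point_vec N k l \<alpha> \<beta> = two_point_vec N k l \<alpha> (s * \<beta>)" for \<alpha> \<beta>
    using query_op_two_point_vec[OF mods(1,2)] by (simp add: s_def)
  have "foldl (query_step n N x) (unit_vec N k) [hadamard_mat n N i, hadamard_mat n N i, store_mat n N i]
      = store_mat n N i *\<^sub>v two_point_vec N k l (of_real r * (of_real r + s * of_real r))
          (s * (of_real r * (of_real r - s * of_real r)))"
    unfolding unit_vec_eq_two_point_vec(1)[OF kl] by (simp add: query hadamard)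
  \<comment> \<open>As \<open>s\<close> is 1 or -1, the amplitudes are \<open>(1, 0)\<close> or
    \<open>(0, - 1)\<close>: a basis vector again, up to sign.\<close>
  also have "\<dots> = store_mat n N i *\<^sub>v two_point_vec N k l (1 / 2 * (1 + s)) (1 / 2 * (s * (1 - s)))"
  proof -
    have "of_real r * (of_real r + s * of_real r) = of_real r * of_real r * (1 + s)"
      "s * (of_real r * (of_real r - s * of_real r)) = of_real r * of_real r * (s * (1 - s))"
      by (simp_all add: algebra_simps)
    then show ?thesis by (simp only: r)
  qed
  also have "\<dots> = unit_vec N (prefix_code x (Suc i) * (n + 1))"
  proof (cases "x ! i")
    case False
    then have "two_point_vec N k l (1 / 2 * (1 + s)) (1 / 2 * (s * (1 - s))) = unit_vec N k"
      by (simp add: s_def unit_vec_eq_two_point_vec(1)[OF kl])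
    then show ?thesis
      using False pair_mat_unit_vec[OF inv(2) less(1) store(1)]
      by (simp add: store_mat_def k_def w_def)
  next
    case True
    then have "two_point_vec N k l (1 / 2 * (1 + s)) (1 / 2 * (s * (1 - s))) = two_point_vec N l k' (- 1) 0"
      using kl by (auto simp: s_def two_point_vec_def)
    then show ?thesis
      using True pair_mat_two_point_vec[OF inv(2) less(2) store(2) lk'] unit_vec_eq_two_point_vec(2)[OF lk', of N]
      by (simp add: store_mat_def k'_def w_def)
  qed
  finally show ?thesis by (simp only: k_def w_def)
qed

lemma computes_bounded_error_exists: "\<exists>T. computes_bounded_error n T f"
proof -
  define N where "N = 2 ^ n * (n + 1)"
  define blocks where "blocks j = concat (map (\<lambda>i. [hadamard_mat n N i, hadamard_mat n N i, store_mat n N i]) [0..<j])" for j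
  \<comment> \<open>The identity fills the slot of the unitary that precedes the first
    query.\<close>
  define Us where "Us = 1\<^sub>m N # blocks n"
  define out where "out x = prefix_code x n * (n + 1)" for x
  define Acc where "Acc = out ` {x \<in> bool_inputs n. f x}"
  have out_less: "out x < N" for x
    using register_bound[OF prefix_code_less[of x n], of 0] by (simp add: out_def N_def)
  have states: "j \<le> n \<Longrightarrow> foldl (query_step n N x) (unit_vec N 0) (blocks j)
      = unit_vec N (prefix_code x j * (n + 1))" for x j
  proof (induction j)
    case (Suc j)
    then show ?case using read_bit[of j n N x] by (simp add: blocks_def N_def)
  qed (simp add: blocks_def)
  have final: "final_state n N Us x = unit_vec N (out x)" for x
    using states[of n x] by (simp add: final_state_def Us_def out_def)
  \<comment> \<open>Distinct inputs end in distinct basis states, so a rejected input never lands in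
    \<open>Acc\<close>.\<close>
  have inj: "x = y" if "out x = out y" "x \<in> bool_inputs n" "y \<in> bool_inputs n" for x y
  proof (rule nth_equalityI)
    have "prefix_code x n = prefix_code y n"
      using that(1) unfolding out_def by (simp only: mult_cancel2) simp
    then show "x ! j = y ! j" if "j < length x" for j
      using that \<open>x \<in> bool_inputs n\<close> by (intro prefix_code_inj[of x n y]) (auto simp: bool_inputs_def)
  qed (use that in \<open>simp add: bool_inputs_def\<close>)
  have Acc: "Acc \<subseteq> {..<N}" using out_less by (auto simp: Acc_def)
  then have "finite Acc" by (rule finite_subset) simp
  have prob: "prob_one n N Us Acc x = (if f x then 1 else 0)" if x: "x \<in> bool_inputs n" for x
  proof -
    have "prob_one n N Us Acc x = (\<Sum>k\<in>Acc. if k = out x then 1 else 0)"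
      unfolding prob_one_def final using Acc out_less
      by (intro sum.cong) (auto simp: unit_vec_def)
    moreover have "out x \<in> Acc \<longleftrightarrow> f x" using x inj by (auto simp: Acc_def)
    ultimately show ?thesis using \<open>finite Acc\<close> by simp
  qed
  have "unitary_mat N (1\<^sub>m N)"
    by (auto simp: unitary_mat_iff if_distrib cong: if_cong)
  then have "\<forall>U\<in>set Us. unitary_mat N U"
    using unitary_hadamard_mat[of _ n "2 ^ n"] unitary_store_mat[of _ n]
    by (auto simp: Us_def blocks_def N_def)
  moreover have "\<forall>x\<in>bool_inputs n. prob_correct n N Us Acc f x \<ge> 2 / 3"
    by (simp add: prob_correct_def prob)
  moreover have "length Us = length (blocks n) + 1" by (simp add: Us_def)
  moreover have "(2::nat) ^ n \<ge> 1" by simp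
  ultimately show ?thesis
    using Acc unfolding computes_bounded_error_def N_def by blast
qed

theorem theorem1p3:
  shows "\<exists>C::real. \<forall>(n::nat) (f::bool list \<Rightarrow> bool). real (bdeg n f) \<le> C * (real (Qcomp n f))\<^sup>2"
proof (intro exI allI)
  fix n and f :: "bool list \<Rightarrow> bool"
  have "computes_bounded_error n (Qcomp n f) f"
    unfolding Qcomp_def using computes_bounded_error_exists by (rule LeastI_ex)
  then show "real (bdeg n f) \<le> 1296 * (real (Qcomp n f))\<^sup>2"
    by (rule bdeg_le_queries)
qed

end
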